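(* For a compact metrizable space $X$ and a continuous map $f:X\to X$, let $S_k(X)$ be the set of all continuous maps $X\to X$ with the compact-open topology, and let $F_f:S_k(X)\to S_k(X)$ be the continuous map $F_f(g)=f\circ g$. Let $P(f)$ be the set of all periodic points of $f$, and let $\mathfrak{c}$ be the cardinality of the continuum. The following hold: (i) Let $X$ be a metrizable (hence first countable) continuum and let $f:X\to X$ be a continuous map. If $|P(f)|<\mathfrak{c}$, then $F_f$ is not periodically dense. (ii) If $f:I\to I$, where $I=[0,1]$, is continuous and periodically dense, then $F_f$ is not transitive. (iii) Let $X$ be a compact metric space and let $f:X\to X$ be a continuous map. If $f$ is transitive, structurally stable and onto-stable, then $F_f$ is not transitive. (iv) Let $X$ be a compact metric space and let $f:X\to X$ be a continuous map. If $f$ is onto-stable and $P(f)\neq X$, then $F_f$ is not periodically dense.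
   Context: The compact-open topology on the set $S(X)$ of all continuous maps $X\to X$ has as subbase the sets $[K,G]=\{g\in S(X): g(K)\subset G\}$ with $K\subset X$ compact and $G\subset X$ open. When $(X,d)$ is a compact metric space it is induced by the uniform metric $\widehat{d}(g,h)=\sup_{x\in X}d(g(x),h(x))$. A continuum is a compact connected Hausdorff space. For a continuous self-map $\varphi:Y\to Y$ of a topological space: a point $y$ is periodic if $\varphi^k(y)=y$ for some integer $k\ge1$; $\varphi$ is periodically dense if its set of periodic points is dense in $Y$; $\varphi$ is (topologically) transitive if for every pair of nonempty open sets $U,V\subset Y$ there is a positive integer $k$ with $\varphi^k(U)\cap V\ne\emptyset$. A continuous self-map $f$ of a compact metric space $(X,d)$ is structurally stable if there is $\varepsilon>0$ such that every $g\in S(X)$ with $\widehat{d}(f,g)<\varepsilon$ is topologically conjugate to $f$ (i.e. $h\circ g=f\circ h$ for some homeomorphism $h:X\to X$). A continuous surjective map $f:X\to X$ is onto-stable if there exists an open set $U$ of $S_k(X)$ such that $f\in U$ and every $g\in U$ is onto (surjective).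
   Formalization: In (i) and (iii), X is additionally assumed to have at least two points; for a one-point (or empty) X the space S_k(X) is a single point and F_f is its identity, which is periodically dense and transitive, so both claims fail there. *)

theory Defs
  imports "HOL-Analysis.Analysis"
begin

text \<open>
  A space is an abstract topology (or metric) on an arbitrary carrier, so a self-map is a function
  on the whole type. Continuous self-maps are taken extensional, so that two of them are equal as
  HOL functions exactly when they agree on the space.
\<close>

definition self_maps :: "'a topology \<Rightarrow> ('a \<Rightarrow> 'a) set" where
  "self_maps X = {g \<in> extensional (topspace X). continuous_map X X g}"

definition subbasic_maps :: "'a topology \<Rightarrow> 'a set \<Rightarrow> 'a set \<Rightarrow> ('a \<Rightarrow> 'a) set" where
  "subbasic_maps X K G = {g \<in> self_maps X. g ` K \<subseteq> G}"

definition compact_open_space :: "'a topology \<Rightarrow> ('a \<Rightarrow> 'a) topology" where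
  "compact_open_space X =
    topology_generated_by {subbasic_maps X K G |K G. compactin X K \<and> openin X G}"

definition postcomp :: "'a topology \<Rightarrow> ('a \<Rightarrow> 'a) \<Rightarrow> ('a \<Rightarrow> 'a) \<Rightarrow> ('a \<Rightarrow> 'a)" where
  "postcomp X f g = compose (topspace X) f g"

definition continuum :: "'a topology \<Rightarrow> bool" where
  "continuum X \<longleftrightarrow> compact_space X \<and> connected_space X \<and> Hausdorff_space X"

definition periodic_points :: "'a topology \<Rightarrow> ('a \<Rightarrow> 'a) \<Rightarrow> 'a set" where
  "periodic_points Y \<phi> = {y \<in> topspace Y. \<exists>k\<ge>1. (\<phi> ^^ k) y = y}"

definition periodically_dense :: "'a topology \<Rightarrow> ('a \<Rightarrow> 'a) \<Rightarrow> bool" where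
  "periodically_dense Y \<phi> \<longleftrightarrow> Y closure_of periodic_points Y \<phi> = topspace Y"

definition topologically_transitive :: "'a topology \<Rightarrow> ('a \<Rightarrow> 'a) \<Rightarrow> bool" where
  "topologically_transitive Y \<phi> \<longleftrightarrow>
    (\<forall>U V. openin Y U \<and> U \<noteq> {} \<and> openin Y V \<and> V \<noteq> {} \<longrightarrow> (\<exists>k>0. (\<phi> ^^ k) ` U \<inter> V \<noteq> {}))"

definition uniform_dist :: "'a metric \<Rightarrow> ('a \<Rightarrow> 'a) \<Rightarrow> ('a \<Rightarrow> 'a) \<Rightarrow> real" where
  "uniform_dist m g h = mdist (cfunspace (mtopology_of m) m) g h"

lemma uniform_dist_eq_SUP:
  assumes m: "compact_space (mtopology_of m)" "mspace m \<noteq> {}"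
    and gh: "g \<in> self_maps (mtopology_of m)" "h \<in> self_maps (mtopology_of m)"
  shows "uniform_dist m g h = (SUP x\<in>mspace m. mdist m (g x) (h x))"
proof -
  have bdd: "f \<in> Metric_space.fspace (mspace m) (mdist m) (mspace m)"
    if f: "f \<in> self_maps (mtopology_of m)" for f
  proof -
    have fc: "continuous_map (mtopology_of m) (mtopology_of m) f"
      using f by (simp add: self_maps_def)
    have "compactin (mtopology_of m) (f ` mspace m)"
      using image_compactin [OF _ fc] m(1) by (simp add: compact_space_def)
    then have "Metric_space.mbounded (mspace m) (mdist m) (f ` mspace m)"
      using Metric_space.compactin_imp_mbounded [OF Metric_space_mspace_mdist]
      by (simp add: mtopology_of_def)
    moreover have "f ` mspace m \<subseteq> mspace m"
      using continuous_map_image_subset_topspace [OF fc] by simp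
    ultimately show ?thesis
      using f by (simp add: Metric_space.fspace_def self_maps_def)
  qed
  show ?thesis
    using bdd [OF gh(1)] bdd [OF gh(2)] m(2)
    by (simp add: uniform_dist_def mdist_cfunspace_eq_mdist_funspace Metric_space.fdist_def)
qed

definition topologically_conjugate :: "'a topology \<Rightarrow> ('a \<Rightarrow> 'a) \<Rightarrow> ('a \<Rightarrow> 'a) \<Rightarrow> bool" where
  "topologically_conjugate X g f \<longleftrightarrow>
    (\<exists>h. homeomorphic_map X X h \<and> (\<forall>x\<in>topspace X. h (g x) = f (h x)))"

definition structurally_stable :: "'a metric \<Rightarrow> ('a \<Rightarrow> 'a) \<Rightarrow> bool" where
  "structurally_stable m f \<longleftrightarrow>
    (\<exists>\<epsilon>>0. \<forall>g\<in>self_maps (mtopology_of m).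
      uniform_dist m f g < \<epsilon> \<longrightarrow> topologically_conjugate (mtopology_of m) g f)"

definition onto_stable :: "'a topology \<Rightarrow> ('a \<Rightarrow> 'a) \<Rightarrow> bool" where
  "onto_stable X f \<longleftrightarrow>
    f \<in> self_maps X \<and> f ` topspace X = topspace X \<and>
    (\<exists>U. openin (compact_open_space X) U \<and> f \<in> U \<and> (\<forall>g\<in>U. g ` topspace X = topspace X))"

lemma Union_subbasic_maps:
  "\<Union>{subbasic_maps X K G |K G. compactin X K \<and> openin X G} = self_maps X"
proof (rule antisym)
  show "\<Union>{subbasic_maps X K G |K G. compactin X K \<and> openin X G} \<subseteq> self_maps X"
    by (rule Union_least) (auto simp: subbasic_maps_def)
  have "self_maps X = subbasic_maps X {} {}"
    by (simp add: subbasic_maps_def)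
  moreover have "compactin X {}" "openin X {}"
    by simp_all
  ultimately have "self_maps X \<in> {subbasic_maps X K G |K G. compactin X K \<and> openin X G}"
    unfolding mem_Collect_eq by (intro exI conjI)
  then show "self_maps X \<subseteq> \<Union>{subbasic_maps X K G |K G. compactin X K \<and> openin X G}"
    by (rule Union_upper)
qed

lemma topspace_compact_open_space [simp]: "topspace (compact_open_space X) = self_maps X"
  by (simp only: compact_open_space_def topology_generated_by_topspace Union_subbasic_maps)

lemma postcomp_self_maps:
  assumes "f \<in> self_maps X" "g \<in> self_maps X"
  shows "postcomp X f g \<in> self_maps X"
proof -
  have "continuous_map X X (f \<circ> g)"
    using assms continuous_map_compose [of X X g X f] by (simp add: self_maps_def)
  then have "continuous_map X X (compose (topspace X) f g)"
    by (rule continuous_map_eq) (simp add: compose_def)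
  then show ?thesis
    by (simp add: postcomp_def self_maps_def compose_def)
qed

lemma continuous_map_postcomp:
  assumes f: "f \<in> self_maps X"
  shows "continuous_map (compact_open_space X) (compact_open_space X) (postcomp X f)"
proof -
  let ?B = "{subbasic_maps X K G |K G. compactin X K \<and> openin X G}"
  have "continuous_map (compact_open_space X) (topology_generated_by ?B) (postcomp X f)"
  proof (rule continuous_on_generated_topo)
    show "postcomp X f ` topspace (compact_open_space X) \<subseteq> \<Union>?B"
      unfolding Union_subbasic_maps topspace_compact_open_space using postcomp_self_maps [OF f] by blast
  next
    fix S assume "S \<in> ?B"
    then obtain K G where KG: "compactin X K" "openin X G" "S = subbasic_maps X K G"
      by blast
    let ?G = "{x \<in> topspace X. f x \<in> G}"
    have K: "K \<subseteq> topspace X"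
      using KG(1) by (rule compactin_subset_topspace)
    have "openin X ?G"
      using f KG(2) unfolding self_maps_def by (blast intro: openin_continuous_map_preimage)
    then have "openin (compact_open_space X) (subbasic_maps X K ?G)"
      unfolding compact_open_space_def
      using KG(1) by (intro topology_generated_by_Basis) blast
    moreover have "(postcomp X f g \<in> S) \<longleftrightarrow> g \<in> subbasic_maps X K ?G"
      if g: "g \<in> self_maps X" for g
    proof -
      have "g x \<in> topspace X" if "x \<in> K" for x
        using g K that by (auto simp: self_maps_def continuous_map_def)
      moreover have "postcomp X f g x = f (g x)" if "x \<in> K" for x
        using K that by (auto simp: postcomp_def compose_def)
      ultimately show ?thesis
        using g postcomp_self_maps [OF f g] unfolding KG(3) subbasic_maps_def
        by (simp add: image_subset_iff)
    qed
    then have "postcomp X f -` S \<inter> topspace (compact_open_space X) = subbasic_maps X K ?G"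
      unfolding topspace_compact_open_space by (auto simp: subbasic_maps_def)
    ultimately show "openin (compact_open_space X)
        (postcomp X f -` S \<inter> topspace (compact_open_space X))"
      by simp
  qed
  then show ?thesis
    by (simp add: compact_open_space_def)
qed

end

theory Submission
  imports Defs
begin

text \<open>
  A map \<open>g\<close> is periodic under \<open>g \<mapsto> f \<circ> g\<close> only if some \<open>f\<^sup>k\<close> fixes the image of \<open>g\<close> pointwise.
  For (iv), density yields a surjective such \<open>g\<close> near \<open>f\<close>, so \<open>f\<^sup>k\<close> is the identity. For (i),
  the image of \<open>g\<close> is a connected metrizable set of fewer than continuum many points, so \<open>g\<close> is
  constant, whereas no map near the identity is constant.
  For (iii), surjective maps near \<open>f\<close> stay surjective under composition with \<open>f\<close>, so they never
  come near a constant map.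
  For (ii), take a periodic point \<open>p\<close> with \<open>0 < p < 1\<close>: a map \<open>g\<close> near the identity has \<open>p\<close> in
  its image, so the image of every \<open>f\<^sup>k \<circ> g\<close> meets the finite orbit of \<open>p\<close>, whereas the maps
  whose image avoids this orbit form a nonempty open set.
\<close>

text \<open>Restricted to points of the space because \<open>compose\<close> returns
  \<open>undefined\<close> elsewhere; it turns iteration in the space of maps into pointwise
  iteration of \<open>f\<close>.\<close>

lemma funpow_postcomp:
  assumes "x \<in> topspace X"
  shows "(postcomp X f ^^ k) g x = (f ^^ k) (g x)"
  using assms by (induction k) (auto simp: postcomp_def compose_def)

lemma openin_subbasic_maps:
  assumes "compactin X K" "openin X G"
  shows "openin (compact_open_space X) (subbasic_maps X K G)"
  unfolding compact_open_space_def
  using assms by (intro topology_generated_by_Basis) blast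

lemma restrict_id_in_self_maps: "restrict id (topspace X) \<in> self_maps X"
proof -
  have "continuous_map X X (restrict id (topspace X))"
    by (rule continuous_map_eq [OF continuous_map_id]) simp
  then show ?thesis
    by (simp add: self_maps_def)
qed

lemma restrict_const_in_self_maps:
  assumes "c \<in> topspace X"
  shows "restrict (\<lambda>_. c) (topspace X) \<in> self_maps X"
proof -
  have "continuous_map X X (\<lambda>_. c)"
    using assms by simp
  then have "continuous_map X X (restrict (\<lambda>_. c) (topspace X))"
    by (rule continuous_map_eq) simp
  then show ?thesis
    by (simp add: self_maps_def)
qed

text \<open>A constant map with value in \<open>G\<close> is a member.\<close>

lemma subbasic_maps_topspace_nonempty:
  assumes "G \<subseteq> topspace X" "G \<noteq> {}"
  shows "subbasic_maps X (topspace X) G \<noteq> {}"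
proof -
  obtain c where "c \<in> G" "c \<in> topspace X"
    using assms by blast
  then have "restrict (\<lambda>_. c) (topspace X) \<in> subbasic_maps X (topspace X) G"
    using restrict_const_in_self_maps by (auto simp: subbasic_maps_def)
  then show ?thesis
    by blast
qed

lemma periodically_dense_postcompD:
  assumes "periodically_dense (compact_open_space X) (postcomp X f)"
    and "openin (compact_open_space X) U" "U \<noteq> {}"
  obtains g k where "g \<in> U" "g \<in> self_maps X" "k \<ge> 1" "\<And>y. y \<in> g ` topspace X \<Longrightarrow> (f ^^ k) y = y"
proof -
  obtain g where g: "g \<in> periodic_points (compact_open_space X) (postcomp X f)" "g \<in> U"
    using assms unfolding periodically_dense_def dense_intersects_open by blast
  then obtain k where k: "k \<ge> 1" "(postcomp X f ^^ k) g = g"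
    by (auto simp: periodic_points_def)
  have "(f ^^ k) y = y" if "y \<in> g ` topspace X" for y
    using that k(2) funpow_postcomp [of _ X k f g] by auto
  moreover have "g \<in> self_maps X"
    using g(1) by (simp add: periodic_points_def)
  ultimately show thesis
    using that g(2) k(1) by blast
qed

lemma topologically_transitive_postcompD:
  assumes "topologically_transitive (compact_open_space X) (postcomp X f)"
    and "openin (compact_open_space X) U" "g\<^sub>0 \<in> U" "openin (compact_open_space X) V" "V \<noteq> {}"
  obtains g k where "g \<in> U" "(postcomp X f ^^ k) g \<in> V"
proof -
  have "\<exists>k>0. (postcomp X f ^^ k) ` U \<inter> V \<noteq> {}"
    using assms unfolding topologically_transitive_def by blast
  then show thesis
    using that by auto
qed

text \<open>With two points, a connected normal T1 space carries a Urysohn function separating them;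
  by connectedness it takes every value in between, so the space has at least continuum many
  points.\<close>

lemma connectedin_lesspoll_real_subset_singleton:
  assumes "metrizable_space X" "connectedin X S" "S \<prec> (UNIV :: real set)"
  shows "\<exists>a. S \<subseteq> {a}"
proof (rule ccontr)
  assume *: "\<nexists>a. S \<subseteq> {a}"
  have S: "topspace (subtopology X S) = S"
    using connectedin_subset_topspace [OF assms(2)] by (simp add: Int_absorb1)
  have "metrizable_space (subtopology X S)"
    using assms(1) by (rule metrizable_space_subtopology)
  then have "(UNIV :: real set) \<lesssim> topspace (subtopology X S)"
    using assms(2) *
    by (intro connected_space_imp_card_ge)
      (auto simp: S connectedin_def metrizable_imp_normal_space metrizable_imp_t1_space)
  then show False
    using assms(3) lesspoll_trans2 lesspoll_not_refl unfolding S by blast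
qed

lemma not_periodically_dense_postcomp_connected:
  assumes X: "connected_space X" "metrizable_space X" "\<nexists>a. topspace X \<subseteq> {a}"
    and P: "periodic_points X f \<prec> (UNIV :: real set)"
  shows "\<not> periodically_dense (compact_open_space X) (postcomp X f)"
proof
  assume dense: "periodically_dense (compact_open_space X) (postcomp X f)"
  obtain p q where pq: "p \<in> topspace X" "q \<in> topspace X" "p \<noteq> q"
    using X(3) by blast
  moreover have "Hausdorff_space X"
    using X(2) by (rule metrizable_imp_Hausdorff_space)
  ultimately obtain A B where AB: "openin X A" "openin X B" "p \<in> A" "q \<in> B" "disjnt A B"
    unfolding Hausdorff_space_def by blast
  \<comment> \<open>Two point conditions already exclude constants: a map in \<open>U\<close> has
    values in the disjoint sets \<open>A\<close> and \<open>B\<close>.\<close>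
  define U where "U = subbasic_maps X {p} A \<inter> subbasic_maps X {q} B"
  have "openin (compact_open_space X) U"
    unfolding U_def using pq AB by (intro openin_Int openin_subbasic_maps) auto
  moreover have "restrict id (topspace X) \<in> U"
    using restrict_id_in_self_maps pq AB by (auto simp: U_def subbasic_maps_def)
  ultimately obtain g k where g: "g \<in> U" "g \<in> self_maps X" "k \<ge> 1"
    "\<And>y. y \<in> g ` topspace X \<Longrightarrow> (f ^^ k) y = y"
    using periodically_dense_postcompD [OF dense] by (metis empty_iff)
  have cont: "continuous_map X X g"
    using g(2) by (simp add: self_maps_def)
  \<comment> \<open>One exponent \<open>k\<close> fixes the whole image, so the bound on the number
    of periodic points passes to the image of \<open>g\<close>.\<close>
  have "g ` topspace X \<subseteq> periodic_points X f"
    using g(3,4) continuous_map_image_subset_topspace [OF cont]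
    unfolding periodic_points_def by blast
  then have "g ` topspace X \<prec> (UNIV :: real set)"
    using P lesspoll_trans1 subset_imp_lepoll by blast
  moreover have "connectedin X (g ` topspace X)"
    using connectedin_continuous_map_image [OF cont] X(1) by (simp add: connectedin_topspace)
  ultimately obtain a where "g ` topspace X \<subseteq> {a}"
    using connectedin_lesspoll_real_subset_singleton [OF X(2)] by blast
  then have "g p = g q"
    using pq by blast
  moreover have "g p \<in> A" "g q \<in> B"
    using g(1) by (auto simp: U_def subbasic_maps_def)
  ultimately show False
    using AB(5) by (auto simp: disjnt_iff)
qed

lemma not_periodically_dense_postcomp_onto_stable:
  assumes "onto_stable X f" "periodic_points X f \<noteq> topspace X"
  shows "\<not> periodically_dense (compact_open_space X) (postcomp X f)"
proof
  assume dense: "periodically_dense (compact_open_space X) (postcomp X f)"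
  obtain U where U: "openin (compact_open_space X) U" "f \<in> U" "\<And>g. g \<in> U \<Longrightarrow> g ` topspace X = topspace X"
    using assms(1) unfolding onto_stable_def by blast
  obtain g k where "g \<in> U" "k \<ge> 1" "\<And>y. y \<in> g ` topspace X \<Longrightarrow> (f ^^ k) y = y"
    using periodically_dense_postcompD [OF dense U(1)] U(2) by (metis empty_iff)
  then have "periodic_points X f = topspace X"
    using U(3) unfolding periodic_points_def by blast
  then show False
    using assms(2) by simp
qed

lemma image_funpow_eq:
  assumes "f ` A = A"
  shows "(f ^^ k) ` A = A"
  by (induction k) (simp_all only: funpow.simps id_def image_ident image_comp [symmetric] assms)

lemma not_transitive_postcomp_onto_stable:
  assumes X: "compact_space X" "t1_space X" "\<nexists>a. topspace X \<subseteq> {a}" and f: "onto_stable X f"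
  shows "\<not> topologically_transitive (compact_open_space X) (postcomp X f)"
proof
  assume trans: "topologically_transitive (compact_open_space X) (postcomp X f)"
  obtain U where U: "openin (compact_open_space X) U" "f \<in> U" "\<And>g. g \<in> U \<Longrightarrow> g ` topspace X = topspace X"
    using f unfolding onto_stable_def by blast
  obtain p q where pq: "p \<in> topspace X" "q \<in> topspace X" "p \<noteq> q"
    using X(3) by blast
  \<comment> \<open>The maps that miss \<open>p\<close>: open because \<open>X\<close> is compact
    and points are closed, nonempty because of the constant map with value \<open>q\<close>.\<close>
  define V where "V = subbasic_maps X (topspace X) (topspace X - {p})"
  have "openin X (topspace X - {p})"
    using X(2) pq(1) by (intro openin_diff) (auto simp: closedin_t1_singleton)
  then have "openin (compact_open_space X) V"
    unfolding V_def using X(1) by (intro openin_subbasic_maps) (simp_all add: compact_space_def)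
  moreover have "V \<noteq> {}"
    unfolding V_def using pq by (intro subbasic_maps_topspace_nonempty) auto
  ultimately obtain k g where g: "g \<in> U" "(postcomp X f ^^ k) g \<in> V"
    using topologically_transitive_postcompD [OF trans U(1,2)] by blast
  \<comment> \<open>Both \<open>g\<close> and \<open>f\<close> are onto, hence so is every iterate
    of \<open>f\<close> after \<open>g\<close>, and \<open>p\<close> is attained.\<close>
  have "p \<in> (f ^^ k) ` g ` topspace X"
    using f pq(1) U(3) [OF g(1)] by (simp add: onto_stable_def image_funpow_eq)
  then obtain x where "x \<in> topspace X" "(postcomp X f ^^ k) g x = p"
    by (auto simp: funpow_postcomp)
  then show False
    using g(2) by (auto simp: V_def subbasic_maps_def)
qed

text \<open>Exponents may be reduced modulo \<open>k\<close>, so the first \<open>k\<close> iterates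
  exhaust the orbit.\<close>

lemma finite_orbit_of_periodic_point:
  assumes "k \<ge> 1" "(f ^^ k) p = p"
  shows "finite (range (\<lambda>n. (f ^^ n) p))"
proof -
  have "(f ^^ n) p = (f ^^ (n mod k)) p" for n
    using funpow_mod_eq [OF assms(2)] by simp
  moreover have "n mod k \<in> {..<k}" for n
    using assms(1) by simp
  ultimately have "range (\<lambda>n. (f ^^ n) p) \<subseteq> (\<lambda>n. (f ^^ n) p) ` {..<k}"
    by blast
  then show ?thesis
    by (rule finite_subset) simp
qed

lemma not_transitive_postcomp_unit_interval:
  assumes "periodically_dense (top_of_set {0..1::real}) f"
  shows "\<not> topologically_transitive (compact_open_space (top_of_set {0..1::real}))
           (postcomp (top_of_set {0..1::real}) f)"
proof
  let ?I = "top_of_set {0..1::real}"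
  assume trans: "topologically_transitive (compact_open_space ?I) (postcomp ?I f)"
  \<comment> \<open>The periodic point is sought in the interior so that there is room on both sides
    of it for the values at 0 and 1.\<close>
  have "openin ?I {0<..<1}"
    by (rule open_subset) auto
  moreover have "{0<..<1::real} \<noteq> {}"
    by simp
  ultimately obtain p where p: "p \<in> periodic_points ?I f" "0 < p" "p < 1"
    using assms unfolding periodically_dense_def dense_intersects_open by fastforce
  define A where "A = range (\<lambda>n. (f ^^ n) p)"
  obtain j where "j \<ge> 1" "(f ^^ j) p = p"
    using p(1) by (auto simp: periodic_points_def)
  then have "finite A"
    unfolding A_def by (rule finite_orbit_of_periodic_point)
  \<comment> \<open>A neighbourhood of the identity whose members pass from below \<open>p\<close>
    to above it.\<close>
  define U where "U = subbasic_maps ?I {0} {0..<p} \<inter> subbasic_maps ?I {1} {p<..1}"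
  have "{0..<p} = {0..1} \<inter> {..<p}" "{p<..1} = {0..1} \<inter> {p<..}"
    using p(2,3) by auto
  then have "openin ?I {0..<p}" "openin ?I {p<..1}"
    by (metis openin_open_Int open_lessThan, metis openin_open_Int open_greaterThan)
  then have U: "openin (compact_open_space ?I) U"
    unfolding U_def by (intro openin_Int openin_subbasic_maps) auto
  have "restrict id {0..1} \<in> U"
    using restrict_id_in_self_maps [of ?I] p(2,3) by (auto simp: U_def subbasic_maps_def)
  \<comment> \<open>The whole orbit is avoided, not just \<open>p\<close>, since the exponent
    supplied by transitivity is not known in advance.\<close>
  define V where "V = subbasic_maps ?I {0..1} ({0..1} - A)"
  have "openin ?I ({0..1} - A)"
    using openin_open_Int [of "- A" "{0..1}"] finite_imp_closed [OF \<open>finite A\<close>]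
    by (simp add: Diff_eq open_Compl)
  then have V: "openin (compact_open_space ?I) V"
    unfolding V_def by (intro openin_subbasic_maps) (simp_all add: compactin_subtopology)
  have "{0..1} - A \<noteq> {}"
    using Diff_infinite_finite [OF \<open>finite A\<close>, of "{0..1}"] by (metis finite.emptyI infinite_Icc zero_less_one)
  then have "V \<noteq> {}"
    unfolding V_def using subbasic_maps_topspace_nonempty [of "{0..1} - A" ?I] by auto
  then obtain k g where g: "g \<in> U" "(postcomp ?I f ^^ k) g \<in> V"
    using topologically_transitive_postcompD [OF trans U \<open>restrict id {0..1} \<in> U\<close> V] by blast
  have "continuous_on {0..1} g" "g 0 \<le> p" "p \<le> g 1"
    using g(1) by (auto simp: U_def subbasic_maps_def self_maps_def)
  then obtain x where x: "0 \<le> x" "x \<le> 1" "g x = p"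
    using IVT' [of g 0 p 1] by auto
  \<comment> \<open>The value is the \<open>k\<close>-th iterate of \<open>f\<close> at
    \<open>p\<close>.\<close>
  then have "(postcomp ?I f ^^ k) g x \<in> A"
    by (simp add: funpow_postcomp A_def)
  then show False
    using g(2) x(1,2) by (auto simp: V_def subbasic_maps_def image_subset_iff)
qed

text \<open>The first and third statements ask for more than one point: otherwise there is a single
  self-map of the space, and postcomposition is trivially both periodically dense and
  transitive.\<close>

theorem theorem4p6:
  shows
    "(\<forall>(X :: 'a topology) f.
        continuum X \<and> metrizable_space X \<and> (\<nexists>a. topspace X \<subseteq> {a}) \<and> f \<in> self_maps X \<and>
        periodic_points X f \<prec> (UNIV :: real set) \<longrightarrow>
        \<not> periodically_dense (compact_open_space X) (postcomp X f))
     \<and>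
     (\<forall>f. f \<in> self_maps (top_of_set {0..1::real}) \<and>
        periodically_dense (top_of_set {0..1::real}) f \<longrightarrow>
        \<not> topologically_transitive (compact_open_space (top_of_set {0..1::real}))
            (postcomp (top_of_set {0..1::real}) f))
     \<and>
     (\<forall>(m :: 'b metric) f.
        compact_space (mtopology_of m) \<and> (\<nexists>a. mspace m \<subseteq> {a}) \<and> f \<in> self_maps (mtopology_of m) \<and>
        topologically_transitive (mtopology_of m) f \<and> structurally_stable m f \<and>
        onto_stable (mtopology_of m) f \<longrightarrow>
        \<not> topologically_transitive (compact_open_space (mtopology_of m)) (postcomp (mtopology_of m) f))
     \<and>
     (\<forall>(m :: 'c metric) f.
        compact_space (mtopology_of m) \<and> f \<in> self_maps (mtopology_of m) \<and>
        onto_stable (mtopology_of m) f \<and>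
        periodic_points (mtopology_of m) f \<noteq> mspace m \<longrightarrow>
        \<not> periodically_dense (compact_open_space (mtopology_of m)) (postcomp (mtopology_of m) f))"
proof (intro conjI allI impI; elim conjE)
  fix X :: "'a topology" and f
  assume "continuum X" "metrizable_space X" "\<nexists>a. topspace X \<subseteq> {a}"
    and "periodic_points X f \<prec> (UNIV :: real set)"
  then show "\<not> periodically_dense (compact_open_space X) (postcomp X f)"
    by (intro not_periodically_dense_postcomp_connected) (simp_all add: continuum_def)
next
  fix f
  assume "periodically_dense (top_of_set {0..1::real}) f"
  then show "\<not> topologically_transitive (compact_open_space (top_of_set {0..1::real}))
      (postcomp (top_of_set {0..1::real}) f)"
    by (rule not_transitive_postcomp_unit_interval)
next
  fix m :: "'b metric" and f
  assume "compact_space (mtopology_of m)" "\<nexists>a. mspace m \<subseteq> {a}" "onto_stable (mtopology_of m) f"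
  moreover have "t1_space (mtopology_of m)"
    by (simp add: mtopology_of_def Metric_space.t1_space_mtopology)
  ultimately show "\<not> topologically_transitive (compact_open_space (mtopology_of m)) (postcomp (mtopology_of m) f)"
    by (intro not_transitive_postcomp_onto_stable) simp_all
next
  fix m :: "'c metric" and f
  assume "onto_stable (mtopology_of m) f" "periodic_points (mtopology_of m) f \<noteq> mspace m"
  then show "\<not> periodically_dense (compact_open_space (mtopology_of m)) (postcomp (mtopology_of m) f)"
    by (intro not_periodically_dense_postcomp_onto_stable) simp_all
qed

end
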